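(* There are $\mathfrak{c}$ many Luzin families on $\omega$ whose $\Psi$-spaces are pairwise non-homeomorphic.
   Context: An almost disjoint (AD) family on $\omega$ is a family of infinite subsets of $\omega$ any two distinct members of which have finite intersection. An AD family $\mathcal{A}$ is Luzin if it can be enumerated as $\mathcal{A} = \langle A_\alpha : \alpha < \omega_1 \rangle$ so that for every $\alpha < \omega_1$ and every $n \in \omega$ the set $\{\beta < \alpha : A_\alpha \cap A_\beta \subseteq n\}$ is finite. For an AD family $\mathcal{A}$, the space $\Psi(\mathcal{A})$ has underlying set $\omega \cup \mathcal{A}$; points of $\omega$ are isolated, and basic neighborhoods of a point $x \in \mathcal{A}$ are the sets $\{x\} \cup (x \setminus F)$ with $F \subseteq \omega$ finite. *)

theory Defs
  imports "HOL-Analysis.Analysis" "HOL-Library.Equipollence"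
begin

definition AD_family :: "nat set set \<Rightarrow> bool" where
  "AD_family \<A> \<longleftrightarrow> (\<forall>A\<in>\<A>. infinite A) \<and>
     (\<forall>A\<in>\<A>. \<forall>B\<in>\<A>. A \<noteq> B \<longrightarrow> finite (A \<inter> B))"

abbreviation omega1 :: "nat set rel" where
  "omega1 \<equiv> cardSuc natLeq"

definition Luzin :: "nat set set \<Rightarrow> bool" where
  "Luzin \<A> \<longleftrightarrow> AD_family \<A> \<and>
     (\<exists>f. bij_betw f (Field omega1) \<A> \<and>
        (\<forall>\<alpha>\<in>Field omega1. \<forall>n::nat.
           finite {\<beta>. (\<beta>, \<alpha>) \<in> omega1 \<and> \<beta> \<noteq> \<alpha> \<and> f \<alpha> \<inter> f \<beta> \<subseteq> {..<n}}))"

definition Psi_space :: "nat set set \<Rightarrow> (nat + nat set) topology" where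
  "Psi_space \<A> = topology (\<lambda>U. U \<subseteq> range Inl \<union> Inr ` \<A> \<and>
     (\<forall>x. Inr x \<in> U \<longrightarrow> (\<exists>F. finite F \<and> Inl ` (x - F) \<subseteq> U)))"

end

theory Submission
  imports Defs "HOL-Library.Countable_Set_Type"
begin

text \<open>
  Sizes of pairwise intersections are an invariant up to a bounded error. A homeomorphism of
  \<open>\<Psi>\<close>-spaces restricts to a permutation of \<open>\<omega>\<close> which carries each member of the first family to
  a member of the second one modulo a finite set, and for uncountably many members these finite
  sets lie below a common \<open>n\<close>; for two such members the sizes of the intersections in the two
  families differ by at most \<open>n\<close>. Luzin's construction allows all intersection sizes to be taken
  from a prescribed infinite set \<open>Z\<close> and to be unbounded on every uncountable subfamily. Apply it
  to \<open>\<cc>\<close> many infinite sets \<open>Z\<close> of powers of two which are almost disjoint, so that elements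
  of two of them are eventually far apart.
\<close>

section \<open>Sets spread over a countable almost disjoint family\<close>

text \<open>This is what one stage of Luzin's construction must achieve. The last clause implies
  Luzin's condition, as a subset of \<open>{..<n}\<close> has at most \<open>n\<close> elements; it
  counts points instead of locating them because sizes are what survives a homeomorphism up to a
  bounded error.\<close>

definition spread :: "nat set \<Rightarrow> nat set set \<Rightarrow> nat set \<Rightarrow> bool" where
  "spread Z C X \<longleftrightarrow> infinite X \<and> (\<forall>B\<in>C. finite (X \<inter> B) \<and> card (X \<inter> B) \<in> Z) \<and>
     (\<forall>k. finite {B\<in>C. card (X \<inter> B) \<le> k})"

text \<open>Each point of \<open>D - G\<close> that is added raises the size of the trace on
  \<open>B\<close> by exactly one, so every large enough element of \<open>Z\<close> can be reached.
  Confining the new points to \<open>D\<close> protects the traces on sets disjoint from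
  \<open>D\<close>.\<close>

lemma extend_to_card_in:
  fixes G B D :: "nat set"
  assumes "finite G" "infinite D" "D \<subseteq> B" "infinite Z"
  shows "\<exists>G'. finite G' \<and> G \<subseteq> G' \<and> G' - G \<subseteq> D \<and> card (G' \<inter> B) \<in> Z \<and> n < card (G' \<inter> B)"
proof -
  obtain z where z: "z \<in> Z" "n + card (G \<inter> B) < z"
    using assms(4) infinite_nat_iff_unbounded by blast
  have "infinite (D - G)" using assms by simp
  then obtain T where T: "finite T" "card T = z - card (G \<inter> B)" "T \<subseteq> D - G"
    using infinite_arbitrarily_large by blast
  have "(G \<union> T) \<inter> B = (G \<inter> B) \<union> T" using T assms by auto
  moreover have "card ((G \<inter> B) \<union> T) = card (G \<inter> B) + card T"
    using T assms by (intro card_Un_disjoint) auto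
  ultimately have "card ((G \<union> T) \<inter> B) = z" using T z by simp
  then show ?thesis using T z assms by (intro exI[of _ "G \<union> T"]) auto
qed

text \<open>Enumerate \<open>C\<close> and treat its members one by one. Stage \<open>n\<close> adds
  finitely many points of \<open>B n\<close> avoiding all earlier \<open>B i\<close>, which brings
  the trace on \<open>B n\<close> to a size in \<open>Z\<close> above \<open>n\<close>; later stages
  never touch \<open>B n\<close> again.\<close>

lemma spread_exists:
  assumes C: "countable C" "infinite C" "AD_family C" and Z: "infinite Z"
  shows "\<exists>X. spread Z C X"
proof -
  define B where "B = from_nat_into C"
  have bij: "bij_betw B UNIV C"
    unfolding B_def using C by (rule_tac bij_betw_from_nat_into)
  have inf_diff: "infinite (B n - (\<Union>i<n. B i))" for n
  proof -
    have "B i \<noteq> B n" if "i < n" for i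
      using bij that by (metis UNIV_I bij_betw_iff_bijections less_irrefl)
    moreover have "B i \<in> C" for i using bij by (auto simp: bij_betw_def)
    ultimately have "finite (B n \<inter> B i)" if "i < n" for i
      using C(3) that unfolding AD_family_def by metis
    then have fin: "finite (B n \<inter> (\<Union>i<n. B i))"
      unfolding Int_UN_distrib by (intro finite_UN_I) simp_all
    have "infinite (B n)" using C(3) \<open>\<And>i. B i \<in> C\<close> unfolding AD_family_def by blast
    then show ?thesis using fin by (metis Int_Diff_Un finite_Un)
  qed
  \<comment> \<open>\<open>G n\<close> is the set before stage \<open>n\<close>, so the final trace
    on \<open>B n\<close> is already visible in \<open>G (Suc n)\<close>.\<close>
  have "\<exists>G. \<forall>n. finite (G n) \<and> (G n \<subseteq> G (Suc n) \<and> G (Suc n) - G n \<subseteq> B n - (\<Union>i<n. B i) \<and>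
      card (G (Suc n) \<inter> B n) \<in> Z \<and> n < card (G (Suc n) \<inter> B n))"
    by (rule dependent_nat_choice) (use extend_to_card_in[OF _ inf_diff Diff_subset Z] in auto)
  then obtain G where "\<forall>n. finite (G n) \<and> (G n \<subseteq> G (Suc n) \<and>
      G (Suc n) - G n \<subseteq> B n - (\<Union>i<n. B i) \<and>
      card (G (Suc n) \<inter> B n) \<in> Z \<and> n < card (G (Suc n) \<inter> B n))" ..
  then have G: "finite (G n)" "G n \<subseteq> G (Suc n)"
      "G (Suc n) - G n \<subseteq> B n - (\<Union>i<n. B i)"
      "card (G (Suc n) \<inter> B n) \<in> Z" "n < card (G (Suc n) \<inter> B n)" for n
    by simp_all
  define X where "X = (\<Union>n. G n)"
  have mono: "G m \<subseteq> G n" if "m \<le> n" for m n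
    using G(2) that by (rule lift_Suc_mono_le)
  have late: "G m \<inter> B n \<subseteq> G (Suc n)" if "Suc n \<le> m" for m n
    using that
  proof (induction m rule: dec_induct)
    case (step m)
    then have "n < m" by simp
    then show ?case using G(3)[of m] step by blast
  qed simp
  have XB: "X \<inter> B n = G (Suc n) \<inter> B n" for n
  proof -
    have "G m \<inter> B n \<subseteq> G (Suc n)" for m
      using late[of n m] mono[of m "Suc n"] by (cases "Suc n \<le> m") auto
    then show ?thesis unfolding X_def by blast
  qed
  \<comment> \<open>A finite \<open>X\<close> would meet the set with index \<open>card X\<close> in
    more than \<open>card X\<close> points.\<close>
  have "infinite X"
  proof
    assume fin: "finite X"
    then have "card (X \<inter> B (card X)) \<le> card X" by (intro card_mono) auto
    then show False using G(5)[of "card X"] XB by simp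
  qed
  moreover have "finite {B\<in>C. card (X \<inter> B) \<le> k}" for k
  proof (rule finite_subset)
    show "{B\<in>C. card (X \<inter> B) \<le> k} \<subseteq> B ` {..k}"
    proof
      fix A assume A: "A \<in> {B\<in>C. card (X \<inter> B) \<le> k}"
      then obtain n where "A = B n" using bij by (auto simp: bij_betw_def)
      then show "A \<in> B ` {..k}" using G(5)[of n] XB[of n] A by auto
    qed
  qed simp
  moreover have "finite (X \<inter> A) \<and> card (X \<inter> A) \<in> Z" if A: "A \<in> C" for A
  proof -
    obtain n where "A = B n" using bij A by (auto simp: bij_betw_def)
    then show ?thesis using G XB by simp
  qed
  ultimately show ?thesis unfolding spread_def by blast
qed

section \<open>The first uncountable ordinal\<close>

lemma countable_underS_omega1:
  assumes "\<alpha> \<in> Field omega1"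
  shows "countable (underS omega1 \<alpha>)"
proof -
  include cardinal_syntax
  have "|underS omega1 \<alpha>| <o omega1"
    using card_of_underS[OF cardSuc_Card_order[OF natLeq_Card_order] assms] .
  then have "|underS omega1 \<alpha>| \<le>o natLeq"
    by (simp add: cardSuc_ordLeq_ordLess natLeq_Card_order card_of_Card_order)
  then show ?thesis by (simp add: countable_card_le_natLeq)
qed

lemma uncountable_Field_omega1: "uncountable (Field omega1)"
proof
  include cardinal_syntax
  assume "countable (Field omega1)"
  then have "|Field omega1| \<le>o natLeq" by (simp add: countable_card_le_natLeq)
  moreover have "omega1 =o |Field omega1|"
    by (simp add: card_of_Field_ordIso cardSuc_Card_order natLeq_Card_order ordIso_symmetric)
  ultimately have "omega1 \<le>o natLeq" by (rule ordIso_ordLeq_trans[rotated])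
  then show False
    using cardSuc_greater[OF natLeq_Card_order] not_ordLess_ordLeq by blast
qed

lemma Well_order_omega1: "Well_order omega1"
  by (simp add: cardSuc_Card_order natLeq_Card_order card_order_on_well_order_on)

lemma omega1_less_cases:
  assumes "\<alpha> \<in> Field omega1" "\<beta> \<in> Field omega1" "\<alpha> \<noteq> \<beta>"
  shows "\<alpha> \<in> underS omega1 \<beta> \<or> \<beta> \<in> underS omega1 \<alpha>"
  using Well_order_omega1 assms
  unfolding well_order_on_def linear_order_on_def total_on_def underS_def by blast

section \<open>Transfinite construction of Luzin families\<close>

definition columns :: "nat set set" where
  "columns = range (\<lambda>n. (\<lambda>k. prod_encode (n, k)) ` UNIV)"

lemma columns: "countable columns" "infinite columns" "AD_family columns"
proof -
  have disj: "(\<lambda>k. prod_encode (m, k)) ` UNIV \<inter> (\<lambda>k. prod_encode (n, k)) ` UNIV = {}"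
    if "m \<noteq> n" for m n
    using that by auto
  have inf: "infinite ((\<lambda>k. prod_encode (n, k)) ` UNIV)" for n
    by (rule range_inj_infinite) (auto intro: injI)
  have "inj (\<lambda>n. (\<lambda>k. prod_encode (n, k)) ` UNIV)"
  proof (rule injI)
    fix m n
    assume "(\<lambda>k. prod_encode (m, k)) ` UNIV = (\<lambda>k. prod_encode (n, k)) ` UNIV"
    then show "m = n" using disj[of m n] by auto
  qed
  then show "infinite columns" unfolding columns_def by (rule range_inj_infinite)
  show "countable columns" unfolding columns_def by simp
  show "AD_family columns"
    unfolding AD_family_def
  proof (intro conjI ballI impI)
    fix A B assume "A \<in> columns" "B \<in> columns" "A \<noteq> B"
    then obtain m n where "A = (\<lambda>k. prod_encode (m, k)) ` UNIV"
      "B = (\<lambda>k. prod_encode (n, k)) ` UNIV" "m \<noteq> n"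
      unfolding columns_def by blast
    then show "finite (A \<inter> B)" using disj[of m n] by simp
  qed (use inf in \<open>auto simp: columns_def\<close>)
qed

text \<open>The columns serve as extra predecessors, so that every stage, also an early one, has
  infinitely many sets to be spread over.\<close>
lemma spread_sequence_exists:
  assumes Z: "infinite Z"
  shows "\<exists>f. \<forall>\<alpha>. \<alpha> \<in> Field omega1 \<longrightarrow> spread Z (columns \<union> f ` underS omega1 \<alpha>) (f \<alpha>)"
proof -
  let ?R = "omega1 - Id"
  \<comment> \<open>The recursion runs over the whole type, so membership in the field is a premise
    inside the predicate, and other points get an arbitrary value.\<close>
  let ?P = "\<lambda>f \<alpha> X. \<alpha> \<in> Field omega1 \<longrightarrow> spread Z (columns \<union> f ` underS omega1 \<alpha>) X"
  have "wf ?R" using Well_order_omega1 by (simp add: well_order_on_def)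
  moreover have "?P f \<alpha> X = ?P g \<alpha> X" if "\<And>\<beta>. (\<beta>, \<alpha>) \<in> ?R \<Longrightarrow> f \<beta> = g \<beta>" for f g \<alpha> X
  proof -
    have "f ` underS omega1 \<alpha> = g ` underS omega1 \<alpha>"
      by (rule image_cong) (use that in \<open>auto simp: underS_def\<close>)
    then show ?thesis by simp
  qed
  moreover have "\<exists>X. ?P f \<alpha> X" if IH: "\<And>\<beta>. (\<beta>, \<alpha>) \<in> ?R \<Longrightarrow> ?P f \<beta> (f \<beta>)" for f \<alpha>
  proof (cases "\<alpha> \<in> Field omega1")
    case True
    have sp: "spread Z (columns \<union> f ` underS omega1 \<beta>) (f \<beta>)" "\<beta> \<in> Field omega1"
      if "\<beta> \<in> underS omega1 \<alpha>" for \<beta>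
      using IH[of \<beta>] that by (auto simp: underS_def Field_def)
    \<comment> \<open>Of two earlier stages, the later one was spread over a family that contains
      the value of the other.\<close>
    have fin: "finite (f \<beta> \<inter> f \<gamma>)"
      if "\<beta> \<in> underS omega1 \<alpha>" "\<gamma> \<in> underS omega1 \<alpha>" "f \<beta> \<noteq> f \<gamma>" for \<beta> \<gamma>
    proof -
      have "\<beta> \<in> underS omega1 \<gamma> \<or> \<gamma> \<in> underS omega1 \<beta>"
        using omega1_less_cases[of \<beta> \<gamma>] sp(2) that by blast
      moreover have "finite (f \<delta> \<inter> f \<epsilon>)"
        if "\<delta> \<in> underS omega1 \<alpha>" "\<epsilon> \<in> underS omega1 \<delta>" for \<delta> \<epsilon>
        using sp(1)[OF that(1)] that(2) by (auto simp: spread_def)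
      ultimately show ?thesis using that(1,2) by (metis Int_commute)
    qed
    have col: "infinite (f \<beta>)" "finite (f \<beta> \<inter> C)" "finite (C \<inter> f \<beta>)"
      if "\<beta> \<in> underS omega1 \<alpha>" "C \<in> columns" for \<beta> C
      using sp(1)[OF that(1)] that(2) by (auto simp: spread_def Int_commute[of C "f \<beta>"])
    have "AD_family (columns \<union> f ` underS omega1 \<alpha>)"
      unfolding AD_family_def
    proof (intro conjI ballI impI)
      fix A assume "A \<in> columns \<union> f ` underS omega1 \<alpha>"
      then show "infinite A"
        using columns(3) sp(1) by (auto simp: AD_family_def spread_def)
    next
      fix A B assume "A \<in> columns \<union> f ` underS omega1 \<alpha>" "B \<in> columns \<union> f ` underS omega1 \<alpha>"
        and ne: "A \<noteq> B"
      then consider "A \<in> columns" "B \<in> columns"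
        | \<beta> where "\<beta> \<in> underS omega1 \<alpha>" "A = f \<beta>" "B \<in> columns"
        | \<beta> where "\<beta> \<in> underS omega1 \<alpha>" "B = f \<beta>" "A \<in> columns"
        | \<beta> \<gamma> where "\<beta> \<in> underS omega1 \<alpha>" "\<gamma> \<in> underS omega1 \<alpha>" "A = f \<beta>" "B = f \<gamma>"
        by (elim UnE imageE) metis+
      then show "finite (A \<inter> B)"
      proof cases
        case 1
        then show ?thesis using columns(3) ne by (simp add: AD_family_def)
      qed (use ne col fin in simp_all)
    qed
    moreover have "countable (columns \<union> f ` underS omega1 \<alpha>)"
      using columns countable_underS_omega1[OF True] by simp
    ultimately show ?thesis using spread_exists[OF _ _ _ Z] columns(2) by (metis finite_Un)
  qed simp
  ultimately show ?thesis by (rule dependent_wf_choice)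
qed

text \<open>A countably infinite \<open>D \<subseteq> I\<close> together with all predecessors of
  its elements is still countable, so some element of \<open>I\<close> escapes it and therefore lies
  above all of \<open>D\<close>.\<close>

lemma uncountable_infinite_underS:
  assumes I: "I \<subseteq> Field omega1" "uncountable I"
  shows "\<exists>\<alpha>\<in>I. infinite (I \<inter> underS omega1 \<alpha>)"
proof -
  obtain D where D: "D \<subseteq> I" "infinite D" "countable D"
    using infinite_countable_subset'[OF uncountable_infinite[OF I(2)]] by blast
  have "countable (D \<union> (\<Union>\<delta>\<in>D. underS omega1 \<delta>))"
    using D I countable_underS_omega1 by (intro countable_Un countable_UN) auto
  then have "\<not> I \<subseteq> D \<union> (\<Union>\<delta>\<in>D. underS omega1 \<delta>)"
    using I(2) countable_subset by metis
  then obtain \<alpha> where \<alpha>: "\<alpha> \<in> I" "\<alpha> \<notin> D" "\<And>\<delta>. \<delta> \<in> D \<Longrightarrow> \<alpha> \<notin> underS omega1 \<delta>"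
    by auto
  then have "D \<subseteq> I \<inter> underS omega1 \<alpha>"
    using D I omega1_less_cases[of \<alpha>] by blast
  then show ?thesis using D(2) \<alpha>(1) infinite_super by blast
qed

text \<open>For the last clause, an uncountable subfamily has a member with infinitely many
  predecessors in the subfamily, and only finitely many of these meet it in at most \<open>k\<close>
  points.\<close>

lemma Luzin_intersection_sizes:
  assumes Z: "infinite Z"
  shows "\<exists>\<A>. Luzin \<A> \<and> uncountable \<A> \<and> (\<forall>A\<in>\<A>. \<forall>B\<in>\<A>. A \<noteq> B \<longrightarrow> card (A \<inter> B) \<in> Z) \<and>
    (\<forall>\<C>\<subseteq>\<A>. uncountable \<C> \<longrightarrow> (\<forall>k. \<exists>A\<in>\<C>. \<exists>B\<in>\<C>. A \<noteq> B \<and> k < card (A \<inter> B)))"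
proof -
  obtain f where f: "\<And>\<alpha>. \<alpha> \<in> Field omega1 \<Longrightarrow> spread Z (columns \<union> f ` underS omega1 \<alpha>) (f \<alpha>)"
    using spread_sequence_exists[OF Z] by blast
  have inf: "infinite (f \<alpha>)" if "\<alpha> \<in> Field omega1" for \<alpha>
    using f[OF that] by (simp add: spread_def)
  have below: "finite (f \<alpha> \<inter> f \<beta>)" "card (f \<alpha> \<inter> f \<beta>) \<in> Z"
    if "\<alpha> \<in> Field omega1" "\<beta> \<in> underS omega1 \<alpha>" for \<alpha> \<beta>
    using f[OF that(1)] that(2) by (auto simp: spread_def)
  have pair: "finite (f \<alpha> \<inter> f \<beta>) \<and> card (f \<alpha> \<inter> f \<beta>) \<in> Z"
    if "\<alpha> \<in> Field omega1" "\<beta> \<in> Field omega1" "\<alpha> \<noteq> \<beta>" for \<alpha> \<beta>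
    using omega1_less_cases[OF that] below that by (metis Int_commute)
  \<comment> \<open>Equal values at distinct indices would have an infinite set as their
    intersection.\<close>
  have inj: "inj_on f (Field omega1)"
    using pair inf by (metis Int_absorb inj_onI)
  \<comment> \<open>\<open>spread\<close> bounds the number of sets; injectivity of \<open>f\<close>
    turns this into a bound on the number of indices.\<close>
  have few: "finite {\<beta>\<in>underS omega1 \<alpha>. card (f \<alpha> \<inter> f \<beta>) \<le> k}" if "\<alpha> \<in> Field omega1" for \<alpha> k
  proof (rule finite_imageD)
    have "finite {B\<in>columns \<union> f ` underS omega1 \<alpha>. card (f \<alpha> \<inter> B) \<le> k}"
      using f[OF that] by (simp add: spread_def)
    then show "finite (f ` {\<beta>\<in>underS omega1 \<alpha>. card (f \<alpha> \<inter> f \<beta>) \<le> k})"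
      by (rule rev_finite_subset) auto
    show "inj_on f {\<beta>\<in>underS omega1 \<alpha>. card (f \<alpha> \<inter> f \<beta>) \<le> k}"
      by (rule inj_on_subset[OF inj]) (auto simp: underS_def Field_def)
  qed
  let ?A = "f ` Field omega1"
  have "Luzin ?A"
    unfolding Luzin_def
  proof (intro conjI exI[of _ f] ballI allI)
    show "AD_family ?A" unfolding AD_family_def using inf pair by auto
    show "bij_betw f (Field omega1) ?A" using inj by (simp add: bij_betw_def)
    fix \<alpha> and n :: nat assume \<alpha>: "\<alpha> \<in> Field omega1"
    have "card (f \<alpha> \<inter> f \<beta>) \<le> n" if "f \<alpha> \<inter> f \<beta> \<subseteq> {..<n}" for \<beta>
      using card_mono[OF _ that] by simp
    then show "finite {\<beta>. (\<beta>, \<alpha>) \<in> omega1 \<and> \<beta> \<noteq> \<alpha> \<and> f \<alpha> \<inter> f \<beta> \<subseteq> {..<n}}"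
      by (intro finite_subset[OF _ few[OF \<alpha>, of n]]) (auto simp: underS_def)
  qed
  moreover have "uncountable ?A"
    using uncountable_Field_omega1 inj countable_image_inj_on by blast
  moreover have "\<exists>A\<in>\<C>. \<exists>B\<in>\<C>. A \<noteq> B \<and> k < card (A \<inter> B)"
    if \<C>: "\<C> \<subseteq> ?A" "uncountable \<C>" for \<C> k
  proof -
    obtain I where I: "I \<subseteq> Field omega1" "\<C> = f ` I"
      using \<C>(1) by (auto simp: subset_image_iff)
    then have "uncountable I" using \<C>(2) by blast
    then obtain \<alpha> where \<alpha>: "\<alpha> \<in> I" "infinite (I \<inter> underS omega1 \<alpha>)"
      using uncountable_infinite_underS I(1) by blast
    then have "\<not> I \<inter> underS omega1 \<alpha> \<subseteq> {\<beta>\<in>underS omega1 \<alpha>. card (f \<alpha> \<inter> f \<beta>) \<le> k}"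
      using few[of \<alpha> k] I(1) finite_subset by blast
    then obtain \<beta> where \<beta>: "\<beta> \<in> I" "\<beta> \<in> underS omega1 \<alpha>" "k < card (f \<alpha> \<inter> f \<beta>)"
      by (auto simp: subset_iff not_le)
    then have "f \<alpha> \<noteq> f \<beta>"
      using inj \<alpha>(1) I(1) by (auto simp: underS_def inj_on_def)
    then show ?thesis using \<beta> \<alpha>(1) I(2) by blast
  qed
  moreover have "card (A \<inter> B) \<in> Z" if "A \<in> ?A" "B \<in> ?A" "A \<noteq> B" for A B
    using pair that by auto
  ultimately show ?thesis by (intro exI[of _ ?A]) simp
qed

section \<open>Homeomorphisms of \<open>\<Psi>\<close>-spaces\<close>

lemma openin_Psi_space:
  "openin (Psi_space \<A>) U \<longleftrightarrow> U \<subseteq> range Inl \<union> Inr ` \<A> \<and>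
     (\<forall>x. Inr x \<in> U \<longrightarrow> (\<exists>F. finite F \<and> Inl ` (x - F) \<subseteq> U))"
proof -
  let ?O = "\<lambda>U. U \<subseteq> range Inl \<union> Inr ` \<A> \<and>
     (\<forall>x. Inr x \<in> U \<longrightarrow> (\<exists>F. finite F \<and> Inl ` (x - F) \<subseteq> U))"
  have "istopology ?O"
    unfolding istopology_def
  proof (intro conjI allI impI)
    fix S T x assume *: "?O S" "?O T"
    then show "S \<inter> T \<subseteq> range Inl \<union> Inr ` \<A>" by blast
    assume "Inr x \<in> S \<inter> T"
    then obtain F G where "finite F" "Inl ` (x - F) \<subseteq> S" "finite G" "Inl ` (x - G) \<subseteq> T"
      using * by blast
    then show "\<exists>F. finite F \<and> Inl ` (x - F) \<subseteq> S \<inter> T"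
      by (intro exI[of _ "F \<union> G"]) auto
  next
    fix \<K> x assume *: "\<forall>K\<in>\<K>. ?O K"
    then show "\<Union>\<K> \<subseteq> range Inl \<union> Inr ` \<A>" by blast
    assume "Inr x \<in> \<Union>\<K>"
    then show "\<exists>F. finite F \<and> Inl ` (x - F) \<subseteq> \<Union>\<K>"
      using * by (meson UnionE Union_upper subset_trans)
  qed
  then show ?thesis unfolding Psi_space_def by (simp add: topology_inverse')
qed

lemma topspace_Psi_space: "topspace (Psi_space \<A>) = range Inl \<union> Inr ` \<A>"
proof
  have "openin (Psi_space \<A>) (range Inl \<union> Inr ` \<A>)"
    unfolding openin_Psi_space by (auto intro: exI[of _ "{}"])
  then show "range Inl \<union> Inr ` \<A> \<subseteq> topspace (Psi_space \<A>)" by (rule openin_subset)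
  show "topspace (Psi_space \<A>) \<subseteq> range Inl \<union> Inr ` \<A>"
    using openin_topspace[of "Psi_space \<A>"] unfolding openin_Psi_space by blast
qed

lemma homeomorphic_maps_open_image:
  assumes "homeomorphic_maps X Y f g" "openin X U"
  shows "openin Y (f ` U)"
  using assms homeomorphic_map_openness_eq homeomorphic_maps_map openin_subset by metis

text \<open>Isolated points go to isolated points, and a point \<open>Inr B\<close> is not isolated
  when \<open>B\<close> is infinite.\<close>

lemma Psi_homeomorphic_Inl:
  assumes h: "homeomorphic_maps (Psi_space \<A>) (Psi_space \<B>) f g"
    and inf: "\<forall>B\<in>\<B>. infinite B"
  shows "\<exists>m. f (Inl n) = Inl m"
proof -
  have "openin (Psi_space \<A>) {Inl n}" by (auto simp: openin_Psi_space)
  then have *: "openin (Psi_space \<B>) {f (Inl n)}"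
    using homeomorphic_maps_open_image[OF h] by fastforce
  show ?thesis
  proof (cases "f (Inl n)")
    case (Inr B)
    then obtain F where "finite F" "Inl ` (B - F) \<subseteq> {Inr B :: nat + nat set}" "B \<in> \<B>"
      using * by (auto simp: openin_Psi_space)
    then have "B - F = {}" by auto
    then show ?thesis using inf \<open>finite F\<close> \<open>B \<in> \<B>\<close> finite_subset by (metis Diff_eq_empty_iff)
  qed simp
qed

text \<open>Since the inverse preserves isolated points, \<open>Inr A\<close> cannot be sent to one.
  The image of the neighborhood consisting of \<open>Inr A\<close> and the points of
  \<open>A\<close> is open, hence contains almost all of \<open>B\<close>. This is one inclusion
  modulo a finite set; the other comes from the inverse map.\<close>

lemma Psi_homeomorphic_Inr:
  assumes h: "homeomorphic_maps (Psi_space \<A>) (Psi_space \<B>) f g"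
    and inf: "\<forall>A\<in>\<A>. infinite A" and A: "A \<in> \<A>"
  shows "\<exists>B\<in>\<B>. f (Inr A) = Inr B \<and> (\<exists>F. finite F \<and> (\<forall>m\<in>B - F. \<exists>n\<in>A. f (Inl n) = Inl m))"
proof -
  have top: "f (Inr A) \<in> topspace (Psi_space \<B>)" and inv: "g (f (Inr A)) = Inr A"
    using h A unfolding homeomorphic_maps_def continuous_map_def
    by (auto simp: topspace_Psi_space)
  have "\<exists>k. g (Inl m) = Inl k" for m
    using Psi_homeomorphic_Inl[OF iffD1[OF homeomorphic_maps_sym h] inf] .
  then have "f (Inr A) \<noteq> Inl m" for m using inv by (metis sum.distinct(1))
  then obtain B where B: "B \<in> \<B>" "f (Inr A) = Inr B"
    using top by (auto simp: topspace_Psi_space)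
  have "openin (Psi_space \<A>) (insert (Inr A) (Inl ` A))"
    using A by (auto simp: openin_Psi_space intro: exI[of _ "{}"])
  then have "openin (Psi_space \<B>) (f ` insert (Inr A) (Inl ` A))"
    by (rule homeomorphic_maps_open_image[OF h])
  then obtain F where F: "finite F" "Inl ` (B - F) \<subseteq> f ` insert (Inr A) (Inl ` A)"
    unfolding openin_Psi_space using B by (metis image_eqI insertI1)
  have "\<exists>n\<in>A. f (Inl n) = Inl m" if "m \<in> B - F" for m
  proof -
    have "Inl m \<in> f ` insert (Inr A) (Inl ` A)" using F(2) that by blast
    then show ?thesis using B(2) by auto
  qed
  then show ?thesis using B F(1) by blast
qed

text \<open>Agreement modulo a finite set is stated through a threshold \<open>n\<close>, so that
  members of \<open>\<A>\<close> can later be sorted into countably many classes.\<close>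

lemma Psi_homeomorphic_permutation:
  assumes h: "Psi_space \<A> homeomorphic_space Psi_space \<B>"
    and inf: "\<forall>A\<in>\<A>. infinite A" "\<forall>B\<in>\<B>. infinite B"
  shows "\<exists>p g. inj p \<and> inj_on g \<A> \<and> g ` \<A> \<subseteq> \<B> \<and>
    (\<forall>A\<in>\<A>. \<exists>n. \<forall>m\<ge>n. m \<in> p ` A \<longleftrightarrow> m \<in> g A)"
proof -
  obtain f f' where h: "homeomorphic_maps (Psi_space \<A>) (Psi_space \<B>) f f'"
    using h unfolding homeomorphic_space_def by blast
  then have h': "homeomorphic_maps (Psi_space \<B>) (Psi_space \<A>) f' f"
    by (rule iffD1[OF homeomorphic_maps_sym])
  have inv: "f' (f x) = x" if "x \<in> range Inl \<union> Inr ` \<A>" for x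
    using h that by (auto simp: homeomorphic_maps_def topspace_Psi_space)
  have inv': "f (f' x) = x" if "x \<in> range Inl \<union> Inr ` \<B>" for x
    using h that by (auto simp: homeomorphic_maps_def topspace_Psi_space)
  obtain p where p: "\<And>n. f (Inl n) = Inl (p n)"
    using Psi_homeomorphic_Inl[OF h inf(2)] by metis
  obtain g where g: "\<And>A. A \<in> \<A> \<Longrightarrow> g A \<in> \<B>" "\<And>A. A \<in> \<A> \<Longrightarrow> f (Inr A) = Inr (g A)"
      and gF: "\<And>A. A \<in> \<A> \<Longrightarrow> \<exists>F. finite F \<and> (\<forall>m\<in>g A - F. \<exists>n\<in>A. f (Inl n) = Inl m)"
    using Psi_homeomorphic_Inr[OF h inf(1)] by metis
  have "inj p" using inv p by (metis UnCI injI rangeI sum.inject(1))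
  moreover have "inj_on g \<A>" using inv g(2) by (metis UnCI inj_onI imageI sum.inject(2))
  moreover have "\<exists>n. \<forall>m\<ge>n. m \<in> p ` A \<longleftrightarrow> m \<in> g A" if A: "A \<in> \<A>" for A
  proof -
    obtain F where F: "finite F" "\<forall>m\<in>g A - F. m \<in> p ` A"
      using gF[OF A] p by (metis image_eqI sum.inject(1))
    \<comment> \<open>This identifies the set that the inverse assigns to \<open>g A\<close> as
      \<open>A\<close> itself, which gives the reverse inclusion.\<close>
    have "f' (Inr (g A)) = Inr A" using inv g(2) A by (metis UnCI imageI)
    then obtain E where E: "finite E" "\<forall>n\<in>A - E. \<exists>m\<in>g A. f' (Inl m) = Inl n"
      using Psi_homeomorphic_Inr[OF h' inf(2) g(1)[OF A]] by auto
    have "p n \<in> g A" if "n \<in> A - E" for n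
      using E(2) that inv' p by (metis UnCI rangeI sum.inject(1))
    then have sub: "p ` A - g A \<subseteq> p ` E" by blast
    have "finite ((p ` A - g A) \<union> (g A - p ` A))"
      using finite_subset[OF sub] finite_subset[of "g A - p ` A" F] E(1) F by auto
    then obtain n where "\<forall>m\<in>(p ` A - g A) \<union> (g A - p ` A). m < n"
      using finite_nat_set_iff_bounded by blast
    then show ?thesis by (intro exI[of _ n]) (auto simp: not_less[symmetric])
  qed
  ultimately show ?thesis using g(1) by blast
qed

section \<open>Separated intersection sizes exclude homeomorphism\<close>

lemma card_le_card_plus_initial:
  fixes X Y :: "nat set"
  assumes "finite Y" "\<forall>m\<ge>n. m \<in> X \<longrightarrow> m \<in> Y"
  shows "card X \<le> card Y + n"
proof -
  have "X \<subseteq> Y \<union> {..<n}" using assms(2) by (auto simp: not_le[symmetric])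
  then have "card X \<le> card (Y \<union> {..<n})" using assms(1) by (intro card_mono) auto
  also have "\<dots> \<le> card Y + n" using card_Un_le[of Y "{..<n}"] by simp
  finally show ?thesis .
qed

text \<open>The assumption \<open>sep\<close> says that for each fixed error \<open>n\<close> only
  boundedly large elements of \<open>Z\<close> are within \<open>n\<close> of an element of
  \<open>W\<close>. Intersections of members sharing the threshold \<open>n\<close> would yield such
  elements beyond any bound.\<close>

lemma not_homeomorphic_if_sizes_separated:
  assumes AD: "AD_family \<A>" "AD_family \<B>" and unc: "uncountable \<A>"
    and sizes: "\<And>A A'. A \<in> \<A> \<Longrightarrow> A' \<in> \<A> \<Longrightarrow> A \<noteq> A' \<Longrightarrow> card (A \<inter> A') \<in> Z"
      "\<And>B B'. B \<in> \<B> \<Longrightarrow> B' \<in> \<B> \<Longrightarrow> B \<noteq> B' \<Longrightarrow> card (B \<inter> B') \<in> W"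
    and unbdd: "\<And>\<C> k. \<C> \<subseteq> \<A> \<Longrightarrow> uncountable \<C> \<Longrightarrow> \<exists>A\<in>\<C>. \<exists>A'\<in>\<C>. A \<noteq> A' \<and> k < card (A \<inter> A')"
    and sep: "\<And>n. \<exists>k. \<forall>z\<in>Z. \<forall>w\<in>W. z \<le> w + n \<longrightarrow> w \<le> z + n \<longrightarrow> z \<le> k"
  shows "\<not> Psi_space \<A> homeomorphic_space Psi_space \<B>"
proof
  assume "Psi_space \<A> homeomorphic_space Psi_space \<B>"
  moreover have "\<forall>A\<in>\<A>. infinite A" "\<forall>B\<in>\<B>. infinite B"
    using AD by (simp_all add: AD_family_def)
  ultimately obtain p g where p: "inj p" and g: "inj_on g \<A>" "g ` \<A> \<subseteq> \<B>"
      and pg: "\<forall>A\<in>\<A>. \<exists>n. \<forall>m\<ge>n. m \<in> p ` A \<longleftrightarrow> m \<in> g A"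
    using Psi_homeomorphic_permutation[of \<A> \<B>] by metis
  define \<C> where "\<C> n = {A\<in>\<A>. \<forall>m\<ge>n. m \<in> p ` A \<longleftrightarrow> m \<in> g A}" for n
  have "\<A> = (\<Union>n. \<C> n)" using pg unfolding \<C>_def by auto
  \<comment> \<open>Countably many classes cover an uncountable family.\<close>
  then obtain n where n: "uncountable (\<C> n)" using unc countable_UN[OF countableI_type, of UNIV \<C>]
    by metis
  obtain k where k: "\<forall>z\<in>Z. \<forall>w\<in>W. z \<le> w + n \<longrightarrow> w \<le> z + n \<longrightarrow> z \<le> k" using sep by blast
  have sub: "\<C> n \<subseteq> \<A>" unfolding \<C>_def by blast
  obtain A A' where A: "A \<in> \<C> n" "A' \<in> \<C> n" "A \<noteq> A'" "k < card (A \<inter> A')"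
    using unbdd[OF sub n] by blast
  then have "A \<in> \<A>" "A' \<in> \<A>" using sub by blast+
  then have mem: "A \<in> \<A>" "A' \<in> \<A>" "g A \<in> \<B>" "g A' \<in> \<B>" "g A \<noteq> g A'"
    using g A(3) inj_on_eq_iff[OF g(1)] by blast+
  then have fin: "finite (A \<inter> A')" "finite (g A \<inter> g A')"
    using AD A(3) by (auto simp: AD_family_def)
  \<comment> \<open>Injectivity of \<open>p\<close> lets the agreement of each member with its image
    pass to intersections without changing the threshold.\<close>
  have im: "p ` (A \<inter> A') = p ` A \<inter> p ` A'" using p by (rule image_Int)
  have c: "card (p ` (A \<inter> A')) = card (A \<inter> A')"
    using p by (meson card_image inj_on_subset subset_UNIV)
  have "\<forall>m\<ge>n. m \<in> p ` (A \<inter> A') \<longleftrightarrow> m \<in> g A \<inter> g A'"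
    using A(1,2) unfolding im \<C>_def by auto
  then have "card (A \<inter> A') \<le> card (g A \<inter> g A') + n" "card (g A \<inter> g A') \<le> card (A \<inter> A') + n"
    using card_le_card_plus_initial[of "g A \<inter> g A'" n "p ` (A \<inter> A')"]
      card_le_card_plus_initial[of "p ` (A \<inter> A')" n "g A \<inter> g A'"] fin c by auto
  then have "card (A \<inter> A') \<le> k" using k sizes mem A(3) by blast
  then show False using A(4) by simp
qed

section \<open>Almost disjoint sets of powers of two\<close>

text \<open>This codes the node of height \<open>n\<close> on the branch \<open>r\<close> of the
  binary tree. Inserting \<open>n\<close> as the greatest element makes the height recoverable from
  the code.\<close>

definition branch :: "nat set \<Rightarrow> nat \<Rightarrow> nat" where
  "branch r n = set_encode (insert n (r \<inter> {..<n}))"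

lemma branch_eqD:
  assumes "branch r m = branch s n"
  shows "m = n" "r \<inter> {..<n} = s \<inter> {..<n}"
proof -
  have eq: "insert m (r \<inter> {..<m}) = insert n (s \<inter> {..<n})"
    using assms inj_on_set_encode unfolding branch_def inj_on_def by auto
  then show mn: "m = n" by (metis IntD2 insertCI insertE lessThan_iff less_asym)
  have "insert n (r \<inter> {..<n}) - {n} = insert n (s \<inter> {..<n}) - {n}" using eq mn by simp
  then show "r \<inter> {..<n} = s \<inter> {..<n}" by auto
qed

text \<open>Distinct powers of two differ by at least half of the larger one.\<close>

lemma powers_of_two_close:
  fixes a b n :: nat
  assumes "2 ^ a \<le> 2 ^ b + n" "2 ^ b \<le> 2 ^ a + n" "a \<noteq> b"
  shows "(2::nat) ^ a \<le> 2 * n"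
proof (cases "a < b")
  case True
  then have "2 * 2 ^ a \<le> (2::nat) ^ b"
    by (metis Suc_leI one_le_numeral power_Suc power_increasing)
  then show ?thesis using assms by linarith
next
  case False
  then have "2 * 2 ^ b \<le> (2::nat) ^ a"
    using assms(3) by (metis Suc_leI linorder_neqE_nat one_le_numeral power_Suc power_increasing)
  then show ?thesis using assms by linarith
qed

text \<open>Codes of different nodes may be adjacent numbers; exponentiation turns distinctness into
  a distance that grows with the numbers.\<close>

definition sizes :: "nat set \<Rightarrow> nat set" where
  "sizes r = range (\<lambda>n. 2 ^ branch r n)"

lemma infinite_sizes: "infinite (sizes r)"
  unfolding sizes_def
  by (rule range_inj_infinite) (auto intro!: injI dest: branch_eqD(1))

lemma sizes_separated:
  assumes "r \<noteq> s"
  shows "\<exists>k. \<forall>z\<in>sizes r. \<forall>w\<in>sizes s. z \<le> w + n \<longrightarrow> w \<le> z + n \<longrightarrow> z \<le> k"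
proof -
  obtain i where i: "(i \<in> r) \<noteq> (i \<in> s)" using assms by blast
  \<comment> \<open>The summand \<open>2 * n\<close> handles distinct powers. The sum handles common
    ones: two branches that differ at \<open>i\<close> share no node of height above
    \<open>i\<close>.\<close>
  define k where "k = 2 * n + (\<Sum>j\<le>i. 2 ^ branch r j)"
  have "2 ^ branch r a \<le> k"
    if le: "2 ^ branch r a \<le> 2 ^ branch s b + n" "2 ^ branch s b \<le> 2 ^ branch r a + n" for a b
  proof (cases "branch r a = branch s b")
    case True
    then have "r \<inter> {..<a} = s \<inter> {..<a}" using branch_eqD by metis
    then have "i \<in> r \<inter> {..<a} \<longleftrightarrow> i \<in> s \<inter> {..<a}" by simp
    then have "a \<le> i" using i by auto
    then have "2 ^ branch r a \<le> (\<Sum>j\<le>i. (2::nat) ^ branch r j)" by (intro member_le_sum) auto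
    then show ?thesis unfolding k_def by simp
  next
    case False
    then show ?thesis using powers_of_two_close[OF le] unfolding k_def by simp
  qed
  then show ?thesis unfolding sizes_def by (intro exI[of _ k]) auto
qed

theorem theorem13:
  shows "\<exists>\<F> :: nat set set set. \<F> \<approx> (UNIV :: real set) \<and> (\<forall>\<A>\<in>\<F>. Luzin \<A>) \<and>
    (\<forall>\<A>\<in>\<F>. \<forall>\<B>\<in>\<F>. \<A> \<noteq> \<B> \<longrightarrow> \<not> (Psi_space \<A> homeomorphic_space Psi_space \<B>))"
proof -
  \<comment> \<open>One Luzin family is chosen for each set \<open>r\<close> of naturals, so the
    index set has the size of the continuum.\<close>
  obtain L where L: "\<And>r. Luzin (L r)" "\<And>r. uncountable (L r)"
      "\<And>r A B. A \<in> L r \<Longrightarrow> B \<in> L r \<Longrightarrow> A \<noteq> B \<Longrightarrow> card (A \<inter> B) \<in> sizes r"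
      "\<And>r \<C> k. \<C> \<subseteq> L r \<Longrightarrow> uncountable \<C> \<Longrightarrow> \<exists>A\<in>\<C>. \<exists>B\<in>\<C>. A \<noteq> B \<and> k < card (A \<inter> B)"
    using Luzin_intersection_sizes[OF infinite_sizes] by metis
  have AD: "AD_family (L r)" for r using L(1) by (simp add: Luzin_def)
  have distinct: "\<not> Psi_space (L r) homeomorphic_space Psi_space (L s)" if "r \<noteq> s" for r s
    by (rule not_homeomorphic_if_sizes_separated[OF AD AD L(2) L(3) L(3) L(4) sizes_separated[OF that]])
  \<comment> \<open>Every space is homeomorphic to itself, so different indices cannot give the same
    family.\<close>
  then have "inj L" using homeomorphic_space_refl by (metis injI)
  then have "range L \<approx> (UNIV :: nat set set)" by (simp add: inj_on_image_eqpoll_self)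
  also have "(UNIV :: nat set set) \<approx> (UNIV :: real set)" by (rule nat_sets_eqpoll_reals)
  finally have "range L \<approx> (UNIV :: real set)" .
  moreover have "\<forall>\<A>\<in>range L. \<forall>\<B>\<in>range L.
      \<A> \<noteq> \<B> \<longrightarrow> \<not> Psi_space \<A> homeomorphic_space Psi_space \<B>"
    using distinct by (metis imageE)
  moreover have "\<forall>\<A>\<in>range L. Luzin \<A>" using L(1) by simp
  ultimately show ?thesis by (intro exI[of _ "range L"] conjI)
qed

end
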